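(* The four Polish monoids $\mathrm{End}_\leq(\mathbf{N})$, $\mathrm{Emb}_\leq(\mathbf{N})$, $\mathrm{Epi}_\leq(\mathbf{N})$ and $\mathrm{End}_\leq^\infty(\mathbf{N})$ are amenable as topological monoids, but all four are non-amenable as (abstract) monoids.
   Context: $\mathbf{N}=\{1,2,\ldots\}$. $\mathrm{End}_\leq(\mathbf{N})$ is the monoid (under composition) of all order-preserving maps $\mathbf{N}\to\mathbf{N}$, i.e. maps with $m\leq n\Rightarrow f(m)\leq f(n)$. Its sub-monoids $\mathrm{Emb}_\leq(\mathbf{N})$, $\mathrm{Epi}_\leq(\mathbf{N})$, $\mathrm{End}_\leq^\infty(\mathbf{N})$ consist respectively of the injective, the surjective, and the unbounded maps. All four are endowed with the topology of pointwise convergence, for which they are Polish topological monoids. A convex compact $M$-space for a monoid $M$ is a convex compact set $K$ in a Hausdorff topological vector space $V$ together with an $M$-action on $V$ by continuous affine transformations preserving $K$. An (abstract) monoid $M$ is amenable if every non-empty convex compact $M$-space has a point of $K$ fixed by $M$; by a theorem of Day this is equivalent to the existence of a left-invariant mean on $M$, i.e. a positive normalized linear functional $m$ on $\ell^\infty(M)$ with $m(x\mapsto f(sx))=m(f)$ for all $f\in\ell^\infty(M)$, $s\in M$. A topological monoid $M$ is amenable (as a topological monoid) if it has this fixed-point property restricted to jointly continuous actions, i.e. for which $M\times K\to K$ is continuous. *)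

theory Defs
  imports "HOL-Analysis.Analysis" "HOL-Algebra.Group" "HOL-Library.Function_Algebras"
begin

section \<open>Topological vector spaces and affine actions\<close>

text \<open>
  The topology is carried explicitly, so that one real vector space type may carry several vector
  topologies; local convexity is not assumed.
\<close>

definition hausdorff_tvs :: "'v::real_vector topology \<Rightarrow> bool" where
  "hausdorff_tvs T \<longleftrightarrow>
     topspace T = UNIV \<and> Hausdorff_space T \<and>
     continuous_map (prod_topology T T) T (\<lambda>(x, y). x + y) \<and>
     continuous_map (prod_topology euclideanreal T) T (\<lambda>(c, x). c *\<^sub>R x)"

definition affine_map :: "('v::real_vector \<Rightarrow> 'w::real_vector) \<Rightarrow> bool" where
  "affine_map f \<longleftrightarrow>
     (\<forall>x y t. f ((1 - t) *\<^sub>R x + t *\<^sub>R y) = (1 - t) *\<^sub>R f x + t *\<^sub>R f y)"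

definition convex_compact_space ::
  "('a, 'b) monoid_scheme \<Rightarrow> 'v::real_vector topology \<Rightarrow> ('a \<Rightarrow> 'v \<Rightarrow> 'v) \<Rightarrow> 'v set \<Rightarrow> bool"
where
  "convex_compact_space M T act K \<longleftrightarrow>
     hausdorff_tvs T \<and> convex K \<and> compactin T K \<and>
     act \<one>\<^bsub>M\<^esub> = id \<and>
     (\<forall>s \<in> carrier M. \<forall>t \<in> carrier M. act (s \<otimes>\<^bsub>M\<^esub> t) = act s \<circ> act t) \<and>
     (\<forall>s \<in> carrier M. continuous_map T T (act s) \<and> affine_map (act s) \<and> act s ` K \<subseteq> K)"

definition has_fixed_point ::
  "('a, 'b) monoid_scheme \<Rightarrow> ('a \<Rightarrow> 'v \<Rightarrow> 'v) \<Rightarrow> 'v set \<Rightarrow> bool"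
where
  "has_fixed_point M act K \<longleftrightarrow> (\<exists>x \<in> K. \<forall>s \<in> carrier M. act s x = x)"


section \<open>Amenability\<close>

text \<open>
  A formula cannot quantify over all vector spaces of all types, so amenability is relative to a
  type of ambient vectors. The unrestricted notion is the property for every type \<open>'v\<close>; hence
  amenability is asserted with \<open>'v\<close> a free type variable, and non-amenability by failure for one
  particular type.
\<close>

definition amenable :: "'v::real_vector itself \<Rightarrow> ('a, 'b) monoid_scheme \<Rightarrow> bool" where
  "amenable _ M \<longleftrightarrow>
     (\<forall>(T :: 'v topology) act K.
        convex_compact_space M T act K \<and> K \<noteq> {} \<longrightarrow> has_fixed_point M act K)"

definition topologically_amenable ::
  "'v::real_vector itself \<Rightarrow> ('a, 'b) monoid_scheme \<Rightarrow> 'a topology \<Rightarrow> bool"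
where
  "topologically_amenable _ M X \<longleftrightarrow>
     (\<forall>(T :: 'v topology) act K.
        convex_compact_space M T act K \<and> K \<noteq> {} \<and>
        continuous_map (prod_topology X (subtopology T K)) (subtopology T K) (\<lambda>(s, x). act s x)
        \<longrightarrow> has_fixed_point M act K)"


section \<open>Functions as vectors\<close>

instantiation "fun" :: (type, real_vector) real_vector
begin

definition scaleR_fun_def: "c *\<^sub>R f = (\<lambda>x. c *\<^sub>R f x)"

instance
  by standard
    (simp_all add: scaleR_fun_def plus_fun_def scaleR_add_right scaleR_add_left)

end

lemma scaleR_fun_apply [simp]: "(c *\<^sub>R f) x = c *\<^sub>R f x"
  by (simp add: scaleR_fun_def)

lemma hausdorff_tvs_product:
  "hausdorff_tvs (product_topology (\<lambda>_::'i. euclideanreal) UNIV)"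
proof -
  let ?T = "product_topology (\<lambda>_::'i. euclideanreal) UNIV"
  have *: "continuous_map ?T euclideanreal (\<lambda>f. f i)" for i
    by (rule continuous_map_product_projection) simp
  have "continuous_map (prod_topology ?T ?T) ?T (\<lambda>(x, y). x + y)"
    unfolding continuous_map_componentwise_UNIV case_prod_unfold plus_fun_apply
    by (intro allI continuous_map_add continuous_map_compose[OF continuous_map_fst *, unfolded o_def]
        continuous_map_compose[OF continuous_map_snd *, unfolded o_def])
  moreover have "continuous_map (prod_topology euclideanreal ?T) ?T (\<lambda>(c, x). c *\<^sub>R x)"
    unfolding continuous_map_componentwise_UNIV case_prod_unfold scaleR_fun_apply real_scaleR_def
    by (intro allI continuous_map_real_mult continuous_map_fst
        continuous_map_compose[OF continuous_map_snd *, unfolded o_def])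
  ultimately show ?thesis
    by (simp add: hausdorff_tvs_def Hausdorff_space_product_topology)
qed

text \<open>
  For a monoid of maps \<open>nat \<Rightarrow> nat\<close>, the next type accommodates the dual of the space of bounded
  real functions on the monoid, whose means are the compact convex set of Day's theorem.
  Non-amenability can therefore always be witnessed in this type.
\<close>

type_synonym day_space = "((nat \<Rightarrow> nat) \<Rightarrow> real) \<Rightarrow> real"


section \<open>The four monoids\<close>

text \<open>
  The ordered set \<open>{1, 2, \<dots>}\<close> is represented by the order-isomorphic type \<open>nat\<close>.
\<close>

definition selfmap_monoid :: "(nat \<Rightarrow> nat) set \<Rightarrow> (nat \<Rightarrow> nat) monoid" where
  "selfmap_monoid S = \<lparr>carrier = S, mult = (\<circ>), one = id\<rparr>"

definition End_le :: "(nat \<Rightarrow> nat) monoid" where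
  "End_le = selfmap_monoid {f. mono f}"

definition Emb_le :: "(nat \<Rightarrow> nat) monoid" where
  "Emb_le = selfmap_monoid {f. mono f \<and> inj f}"

definition Epi_le :: "(nat \<Rightarrow> nat) monoid" where
  "Epi_le = selfmap_monoid {f. mono f \<and> surj f}"

definition End_le_unbounded :: "(nat \<Rightarrow> nat) monoid" where
  "End_le_unbounded = selfmap_monoid {f. mono f \<and> \<not> bdd_above (range f)}"

definition pointwise_topology :: "(nat \<Rightarrow> nat) monoid \<Rightarrow> (nat \<Rightarrow> nat) topology" where
  "pointwise_topology M =
     subtopology (product_topology (\<lambda>_. discrete_topology UNIV) UNIV) (carrier M)"

lemma monoid_selfmap:
  assumes "id \<in> S" and "\<And>f g. f \<in> S \<Longrightarrow> g \<in> S \<Longrightarrow> f \<circ> g \<in> S"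
  shows "monoid (selfmap_monoid S)"
  by (rule monoidI) (simp_all add: selfmap_monoid_def assms comp_assoc)

lemma mono_comp_nat: "mono f \<Longrightarrow> mono g \<Longrightarrow> mono (f \<circ> g)"
  for f g :: "nat \<Rightarrow> nat"
  by (simp add: mono_def)

lemma monoid_End_le: "monoid End_le"
  unfolding End_le_def by (rule monoid_selfmap) (auto simp: mono_def)

lemma monoid_Emb_le: "monoid Emb_le"
  unfolding Emb_le_def by (rule monoid_selfmap) (auto simp: mono_comp_nat inj_compose mono_def)

lemma monoid_Epi_le: "monoid Epi_le"
  unfolding Epi_le_def
proof (rule monoid_selfmap)
  fix f g :: "nat \<Rightarrow> nat"
  assume "f \<in> {f. mono f \<and> surj f}" and "g \<in> {f. mono f \<and> surj f}"
  then show "f \<circ> g \<in> {f. mono f \<and> surj f}"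
    using comp_surj[of g f] mono_comp_nat[of f g] by simp
qed (simp add: mono_def)

lemma monoid_End_le_unbounded: "monoid End_le_unbounded"
  unfolding End_le_unbounded_def
proof (rule monoid_selfmap)
  show "id \<in> {f::nat \<Rightarrow> nat. mono f \<and> \<not> bdd_above (range f)}"
    by (auto simp: mono_def bdd_above_def not_le)
next
  fix f g :: "nat \<Rightarrow> nat"
  assume f: "f \<in> {f. mono f \<and> \<not> bdd_above (range f)}"
    and g: "g \<in> {f. mono f \<and> \<not> bdd_above (range f)}"
  have "\<exists>n. b < f (g n)" for b
  proof -
    obtain m where m: "b < f m"
      using f by (auto simp: bdd_above_def not_le)
    obtain n where "m < g n"
      using g by (auto simp: bdd_above_def not_le)
    then have "f m \<le> f (g n)"
      using f by (simp add: mono_def)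
    with m show ?thesis by (meson less_le_trans)
  qed
  then have "\<not> bdd_above (range (f \<circ> g))"
    by (auto simp: bdd_above_def not_le)
  with f g show "f \<circ> g \<in> {f. mono f \<and> \<not> bdd_above (range f)}"
    by (simp add: mono_comp_nat)
qed

end

theory Submission
  imports Defs "HOL-Library.Ramsey"
begin

text \<open>
  A compact set has a point fixed by the whole monoid as soon as finitely many elements always have
  almost fixed points, and joint continuity makes elements that agree on an initial segment act
  uniformly closely. Then a long shift makes any point almost fixed for embeddings; constants all
  have nearly the same orbit points; and for surjections, which form the monoid of infinite subsets
  under passing to subsets, Ramsey's theorem yields an almost fixed point.

  An invariant mean charges every right ideal fully, which is impossible for the two disjoint ideals
  generated by the embeddings onto the even and the odd numbers. Any two right ideals of the monoid
  of surjections intersect. There, surjections are read as strictly increasing sequences, acted on by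
  passing to subsequences, and the axiom of choice provides an equivariant map from these sequences
  to a circle on which two homeomorphisms play ping-pong, so that it carries no invariant mean.
\<close>

section \<open>Almost fixed points of jointly continuous actions\<close>

lemma tvs_continuous_diff:
  assumes T: "hausdorff_tvs T" and f: "continuous_map X T f" and g: "continuous_map X T g"
  shows "continuous_map X T (\<lambda>x. f x - g x)"
proof -
  have add: "continuous_map (prod_topology T T) T (\<lambda>(x, y). x + y)"
    and scale: "continuous_map (prod_topology euclideanreal T) T (\<lambda>(c, x). c *\<^sub>R x)"
    using T by (auto simp: hausdorff_tvs_def)
  have "continuous_map X (prod_topology euclideanreal T) (\<lambda>x. (- 1, g x))"
    using g by (simp add: continuous_map_paired)
  from continuous_map_compose[OF this scale] have "continuous_map X T (\<lambda>x. - g x)"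
    by (simp add: o_def)
  then have "continuous_map X (prod_topology T T) (\<lambda>x. (f x, - g x))"
    using f by (simp add: continuous_map_paired)
  from continuous_map_compose[OF this add] show ?thesis
    by (simp add: o_def)
qed

lemma openin_tvs_vimage:
  assumes T: "hausdorff_tvs T" and f: "continuous_map T T f" and U: "openin T U"
  shows "openin T {x. f x \<in> U}"
  using openin_continuous_map_preimage[OF f U] T by (simp add: hausdorff_tvs_def)

lemma tvs_diff_neighbourhood:
  assumes T: "hausdorff_tvs T" and U: "openin T U" "0 \<in> U"
  obtains V where "openin T V" "0 \<in> V" "\<And>a b. a \<in> V \<Longrightarrow> b \<in> V \<Longrightarrow> a - b \<in> U"
proof -
  have [simp]: "topspace T = UNIV"
    using T by (simp add: hausdorff_tvs_def)
  have "continuous_map (prod_topology T T) T (\<lambda>p. fst p - snd p)"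
    by (intro tvs_continuous_diff[OF T] continuous_map_fst continuous_map_snd)
  from openin_continuous_map_preimage[OF this U(1)]
  have "openin (prod_topology T T) {p. fst p - snd p \<in> U}"
    by simp
  then have "\<exists>A B. openin T A \<and> openin T B \<and> 0 \<in> A \<and> 0 \<in> B \<and> A \<times> B \<subseteq> {p. fst p - snd p \<in> U}"
    using U(2) by (simp add: openin_prod_topology_alt)
  then obtain A B where AB: "openin T A" "openin T B" "0 \<in> A" "0 \<in> B"
      "A \<times> B \<subseteq> {p. fst p - snd p \<in> U}"
    by auto
  show thesis
    by (rule that[of "A \<inter> B"]) (use AB in auto)
qed

text \<open>If no point of \<open>K\<close> is fixed, each \<open>y\<close> has an \<open>s\<close>
  whose displacement avoids a neighbourhood of 0 throughout a neighbourhood of \<open>y\<close>.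
  Finitely many of these neighbourhoods cover \<open>K\<close>, so the finitely many
  \<open>s\<close> have no common almost fixed point.\<close>

lemma has_fixed_pointI_almost_fixed:
  assumes CC: "convex_compact_space M T act K"
    and approx: "\<And>F U. finite F \<Longrightarrow> F \<subseteq> carrier M \<Longrightarrow> openin T U \<Longrightarrow> 0 \<in> U \<Longrightarrow>
                   \<exists>y\<in>K. \<forall>s\<in>F. act s y - y \<in> U"
  shows "has_fixed_point M act K"
proof (rule ccontr)
  assume no_fix: "\<not> has_fixed_point M act K"
  have T: "hausdorff_tvs T" and K: "compactin T K"
    and cont: "\<And>s. s \<in> carrier M \<Longrightarrow> continuous_map T T (act s)"
    using CC by (auto simp: convex_compact_space_def)
  have "\<exists>s U N. s \<in> carrier M \<and> openin T U \<and> 0 \<in> U \<and> openin T N \<and> y \<in> N \<and>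
      (\<forall>z\<in>N. act s z - z \<notin> U)" if "y \<in> K" for y
  proof -
    obtain s where s: "s \<in> carrier M" "act s y - y \<noteq> 0"
      using no_fix \<open>y \<in> K\<close> by (auto simp: has_fixed_point_def)
    then obtain U P where UP: "openin T U" "openin T P" "0 \<in> U" "act s y - y \<in> P" "disjnt U P"
      using T unfolding hausdorff_tvs_def Hausdorff_space_def by (metis UNIV_I)
    have "openin T {z. act s z - z \<in> P}"
      by (rule openin_tvs_vimage[OF T tvs_continuous_diff[OF T cont[OF s(1)]] UP(2)]) simp
    then show ?thesis
      using s UP by (intro exI[of _ s] exI[of _ U] exI[of _ "{z. act s z - z \<in> P}"])
        (auto simp: disjnt_iff)
  qed
  then obtain s U N where sUN: "\<And>y. y \<in> K \<Longrightarrow> s y \<in> carrier M \<and> openin T (U y) \<and> 0 \<in> U y \<and>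
      openin T (N y) \<and> y \<in> N y \<and> (\<forall>z\<in>N y. act (s y) z - z \<notin> U y)"
    by metis
  have "\<exists>\<F>. finite \<F> \<and> \<F> \<subseteq> N ` K \<and> K \<subseteq> \<Union> \<F>"
    using K sUN by (intro compactinD) auto
  then obtain D where D: "finite D" "D \<subseteq> K" "K \<subseteq> \<Union> (N ` D)"
    by (metis finite_subset_image)
  have "openin T (topspace T \<inter> \<Inter> (U ` D))"
    using D sUN by (intro openin_Int_Inter) auto
  moreover have "0 \<in> topspace T \<inter> \<Inter> (U ` D)"
    using D sUN T by (auto simp: hausdorff_tvs_def)
  moreover have "finite (s ` D)" "s ` D \<subseteq> carrier M"
    using D sUN by auto
  ultimately obtain y where y: "y \<in> K" "\<forall>r\<in>s ` D. act r y - y \<in> topspace T \<inter> \<Inter> (U ` D)"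
    using approx by meson
  then obtain d where "d \<in> D" "y \<in> N d"
    using D(3) by auto
  then show False
    using y D(2) sUN[of d] by auto
qed

section \<open>The pointwise topology and uniform closeness of actions\<close>

lemma carrier_selfmap_monoid [simp]: "carrier (selfmap_monoid S) = S"
  and mult_selfmap_monoid [simp]: "s \<otimes>\<^bsub>selfmap_monoid S\<^esub> t = s \<circ> t"
  and one_selfmap_monoid [simp]: "\<one>\<^bsub>selfmap_monoid S\<^esub> = id"
  by (simp_all add: selfmap_monoid_def)

lemma pointwise_topology_basis:
  assumes "openin (pointwise_topology M) A" and "s \<in> A"
  obtains n where "\<And>s'. s' \<in> carrier M \<Longrightarrow> (\<And>i. i \<le> n \<Longrightarrow> s' i = s i) \<Longrightarrow> s' \<in> A"
proof -
  obtain B where B: "openin (product_topology (\<lambda>_. discrete_topology UNIV) UNIV) B"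
      "A = B \<inter> carrier M"
    using assms(1) by (auto simp: pointwise_topology_def openin_subtopology)
  then obtain U where U: "finite {i. U i \<noteq> UNIV}" "s \<in> PiE UNIV U" "PiE UNIV U \<subseteq> B"
    using assms(2) unfolding openin_product_topology_alt by auto
  from U(1) obtain n where n: "\<And>i. U i \<noteq> UNIV \<Longrightarrow> i \<le> n"
    by (metis (mono_tags, lifting) finite_nat_set_iff_bounded_le mem_Collect_eq)
  show thesis
  proof (rule that)
    fix s' assume s': "s' \<in> carrier M" "\<And>i. i \<le> n \<Longrightarrow> s' i = s i"
    have "s' i \<in> U i" for i
      using n[of i] s'(2)[of i] U(2) by (cases "U i = UNIV") (auto simp: PiE_iff)
    then show "s' \<in> A"
      using U(3) B(2) s'(1) by (auto simp: PiE_iff)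
  qed
qed

locale jointly_continuous_action =
  fixes S :: "(nat \<Rightarrow> nat) set" and T :: "'v::real_vector topology"
    and act :: "(nat \<Rightarrow> nat) \<Rightarrow> 'v \<Rightarrow> 'v" and K :: "'v set"
  assumes space: "convex_compact_space (selfmap_monoid S) T act K"
    and joint: "continuous_map (prod_topology (pointwise_topology (selfmap_monoid S)) (subtopology T K))
                  (subtopology T K) (\<lambda>(s, x). act s x)"
begin

lemma tvs: "hausdorff_tvs T" and compact: "compactin T K"
  and act_id: "act id x = x"
  and act_comp: "s \<in> S \<Longrightarrow> t \<in> S \<Longrightarrow> act (s \<circ> t) x = act s (act t x)"
  and act_in: "s \<in> S \<Longrightarrow> x \<in> K \<Longrightarrow> act s x \<in> K"
  and act_continuous: "s \<in> S \<Longrightarrow> continuous_map T T (act s)"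
  using space by (auto simp: convex_compact_space_def image_subset_iff)

text \<open>Tube lemma: the pairs in \<open>S \<times> K\<close> with small difference form an open
  set containing \<open>{s} \<times> K\<close>, and compactness of \<open>K\<close> makes
  \<open>n\<close> independent of \<open>x\<close>.\<close>

lemma act_uniformly_close:
  assumes s: "s \<in> S" and U: "openin T U" "0 \<in> U"
  obtains n where
    "\<And>s' x. s' \<in> S \<Longrightarrow> (\<And>i. i \<le> n \<Longrightarrow> s' i = s i) \<Longrightarrow> x \<in> K \<Longrightarrow> act s' x - act s x \<in> U"
proof -
  let ?X = "pointwise_topology (selfmap_monoid S)" and ?K = "subtopology T K"
  have [simp]: "topspace T = UNIV"
    using tvs by (simp add: hausdorff_tvs_def)
  have top_X: "topspace ?X = S"
    by (auto simp: pointwise_topology_def)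
  have joint': "continuous_map (prod_topology ?X ?K) T (\<lambda>p. act (fst p) (snd p))"
    using continuous_map_into_fulltopology[OF joint] by (simp add: case_prod_unfold)
  have "continuous_map (prod_topology ?X ?K) T (\<lambda>p. act s (snd p))"
    using continuous_map_compose[OF continuous_map_snd
        continuous_map_from_subtopology[OF act_continuous[OF s]]]
    by (simp add: o_def)
  from openin_continuous_map_preimage[OF tvs_continuous_diff[OF tvs joint' this] U(1)]
  have "openin (prod_topology ?X ?K) {p \<in> S \<times> K. act (fst p) (snd p) - act s (snd p) \<in> U}"
    by (simp add: top_X)
  note open_W = this
  have comp: "compactin ?X {s}" "compactin ?K K"
    using compact s by (auto simp: compactin_subtopology top_X)
  have "{s} \<times> K \<subseteq> {p \<in> S \<times> K. act (fst p) (snd p) - act s (snd p) \<in> U}"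
    using s U by auto
  then obtain A B where AB: "openin ?X A" "{s} \<subseteq> A" "K \<subseteq> B"
      "A \<times> B \<subseteq> {p \<in> S \<times> K. act (fst p) (snd p) - act s (snd p) \<in> U}"
    by (rule Wallace_theorem_prod_topology[OF comp open_W])
  obtain n where "\<And>s'. s' \<in> S \<Longrightarrow> (\<And>i. i \<le> n \<Longrightarrow> s' i = s i) \<Longrightarrow> s' \<in> A"
    using pointwise_topology_basis[OF AB(1), of s] AB(2) by auto
  then show thesis
    using AB(3,4) by (intro that[of n]) fastforce
qed

end

lemma topologically_amenable_selfmapI:
  assumes "\<And>T act K F U.
      jointly_continuous_action S (T :: 'v::real_vector topology) act K \<Longrightarrow> K \<noteq> {} \<Longrightarrow>
      finite F \<Longrightarrow> F \<subseteq> S \<Longrightarrow> openin T U \<Longrightarrow> 0 \<in> U \<Longrightarrow> \<exists>y\<in>K. \<forall>s\<in>F. act s y - y \<in> U"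
  shows "topologically_amenable TYPE('v) (selfmap_monoid S) (pointwise_topology (selfmap_monoid S))"
  unfolding topologically_amenable_def
proof (intro allI impI, elim conjE)
  fix T :: "'v topology" and act K
  assume *: "convex_compact_space (selfmap_monoid S) T act K" "K \<noteq> {}"
    "continuous_map (prod_topology (pointwise_topology (selfmap_monoid S)) (subtopology T K))
       (subtopology T K) (\<lambda>(s, x). act s x)"
  then have "jointly_continuous_action S T act K"
    by (simp add: jointly_continuous_action_def)
  with * show "has_fixed_point (selfmap_monoid S) act K"
    by (intro has_fixed_pointI_almost_fixed[OF *(1)] assms) auto
qed

section \<open>Embeddings, unbounded maps and arbitrary monotone maps\<close>

lemma mono_not_bdd_above_eventually_ge:
  fixes f :: "nat \<Rightarrow> nat"
  assumes "mono f" "\<not> bdd_above (range f)"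
  shows "\<exists>k. \<forall>m\<ge>k. n \<le> f m"
proof -
  obtain k where "n < f k"
    using assms(2) by (auto simp: bdd_above_def not_le)
  then show ?thesis
    using assms(1) by (meson less_imp_le monoD order_trans)
qed

text \<open>
  Far out, every \<open>s\<close> agrees with a map that is close to the identity; hence long shifts make every
  point almost fixed.
\<close>

lemma topologically_amenable_shift:
  assumes id: "id \<in> S" and shift: "\<And>k. (\<lambda>m. m + k) \<in> S"
    and unbounded: "\<And>s. s \<in> S \<Longrightarrow> mono s \<and> \<not> bdd_above (range s)"
    and patch: "\<And>s n. s \<in> S \<Longrightarrow> (\<lambda>m. if m \<le> n then m else max n (s m)) \<in> S"
  shows "topologically_amenable TYPE('v::real_vector) (selfmap_monoid S)
           (pointwise_topology (selfmap_monoid S))"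
proof (rule topologically_amenable_selfmapI)
  fix T :: "'v topology" and act K F U
  assume "jointly_continuous_action S T act K" and K: "K \<noteq> {}" and F: "finite F" "F \<subseteq> S"
    and U: "openin T U" "0 \<in> U"
  then interpret jointly_continuous_action S T act K by simp
  obtain x where x: "x \<in> K"
    using K by auto
  obtain n where n: "\<And>s' x. s' \<in> S \<Longrightarrow> (\<And>i. i \<le> n \<Longrightarrow> s' i = id i) \<Longrightarrow> x \<in> K \<Longrightarrow>
      act s' x - act id x \<in> U"
    using act_uniformly_close[OF id U] by blast
  have "\<forall>s\<in>F. \<exists>k. \<forall>m\<ge>k. n \<le> s m"
    using F(2) unbounded by (auto intro!: mono_not_bdd_above_eventually_ge)
  then obtain c where c: "\<And>s m. s \<in> F \<Longrightarrow> c s \<le> m \<Longrightarrow> n \<le> s m"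
    by metis
  \<comment> \<open>Larger than \<open>n\<close> and than every \<open>c s\<close> (a sum bounds its
    terms), so at \<open>m + k\<close> the patched map takes its second branch and the
    \<open>max\<close> there is inert.\<close>
  define k where "k = Suc n + sum c F"
  let ?y = "act (\<lambda>m. m + k) x"
  have y: "?y \<in> K"
    by (intro act_in shift x)
  have "act s ?y - ?y \<in> U" if "s \<in> F" for s
  proof -
    let ?r = "\<lambda>m. if m \<le> n then m else max n (s m)"
    have s: "s \<in> S"
      using that F by auto
    have "c s \<le> k"
      using member_le_sum[of s F c] that F(1) by (simp add: k_def)
    then have "s \<circ> (\<lambda>m. m + k) = ?r \<circ> (\<lambda>m. m + k)"
      using c[OF that] by (fastforce simp: k_def max_def)
    then have "act s ?y = act ?r ?y"
      by (simp only: act_comp[OF s shift, symmetric] act_comp[OF patch[OF s] shift, symmetric])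
    moreover have "act ?r ?y - act id ?y \<in> U"
      by (rule n[OF patch[OF s]]) (simp_all add: y)
    ultimately show ?thesis
      by (simp add: act_id)
  qed
  with y show "\<exists>y\<in>K. \<forall>s\<in>F. act s y - y \<in> U"
    by blast
qed

lemma inj_not_bdd_above: "inj f \<Longrightarrow> \<not> bdd_above (range f)" for f :: "nat \<Rightarrow> nat"
  using range_inj_infinite[of f] by (auto simp: bdd_above_nat)

lemma topologically_amenable_Emb_le:
  "topologically_amenable TYPE('v::real_vector) Emb_le (pointwise_topology Emb_le)"
  unfolding Emb_le_def
proof (rule topologically_amenable_shift)
  fix s :: "nat \<Rightarrow> nat" and n
  assume s: "s \<in> {f. mono f \<and> inj f}"
  then show "mono s \<and> \<not> bdd_above (range s)"
    by (simp add: inj_not_bdd_above)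
  have "strict_mono s"
    using s by (simp add: strict_mono_iff_mono)
  then have le: "s m < s (Suc m)" "m \<le> s m" "Suc m \<le> s (Suc m)" for m
    by (auto simp: strict_mono_def intro: strict_mono_imp_increasing)
  \<comment> \<open>Since \<open>m \<le> s m\<close>, past \<open>n\<close> the \<open>max\<close>
    is \<open>s m\<close>, and the seam from \<open>n\<close> to \<open>s (Suc n)\<close> is
    strict.\<close>
  have "(if m \<le> n then m else max n (s m)) < (if Suc m \<le> n then Suc m else max n (s (Suc m)))" for m
    using le[of m] by auto
  then have "strict_mono (\<lambda>m. if m \<le> n then m else max n (s m))"
    by (simp add: strict_mono_Suc_iff)
  then show "(\<lambda>m. if m \<le> n then m else max n (s m)) \<in> {f. mono f \<and> inj f}"
    by (simp add: strict_mono_iff_mono)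
qed (auto simp: mono_def inj_def)

lemma topologically_amenable_End_le_unbounded:
  "topologically_amenable TYPE('v::real_vector) End_le_unbounded (pointwise_topology End_le_unbounded)"
  unfolding End_le_unbounded_def
proof (rule topologically_amenable_shift)
  fix s :: "nat \<Rightarrow> nat" and n
  let ?r = "\<lambda>m. if m \<le> n then m else max n (s m)"
  assume s: "s \<in> {f. mono f \<and> \<not> bdd_above (range f)}"
  then show "mono s \<and> \<not> bdd_above (range s)"
    by simp
  have "mono ?r"
    using s by (auto simp: max_def mono_def intro: order_trans)
  moreover have "\<not> bdd_above (range ?r)"
  proof
    assume "bdd_above (range ?r)"
    then obtain b where b: "\<And>m. ?r m \<le> b"
      unfolding bdd_above_def by blast
    obtain k where k: "\<forall>m\<ge>k. Suc b \<le> s m"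
      using mono_not_bdd_above_eventually_ge[of s "Suc b"] s by auto
    show False
      using b[of "k + Suc n"] k[rule_format, of "k + Suc n"] by simp
  qed
  ultimately show "?r \<in> {f. mono f \<and> \<not> bdd_above (range f)}"
    by simp
qed (auto simp: mono_def inj_not_bdd_above[OF inj_on_id, simplified] intro!: inj_not_bdd_above)

text \<open>Constants give orbit points \<open>p k\<close> with
  \<open>act s (p k) = p (s k)\<close>. For each \<open>j\<close> all late \<open>p k\<close> are
  close to \<open>p j\<close>; hence \<open>p 0\<close> and \<open>p (s 0)\<close> are both close to
  a common \<open>p k\<close>.\<close>

lemma topologically_amenable_End_le:
  "topologically_amenable TYPE('v::real_vector) End_le (pointwise_topology End_le)"
  unfolding End_le_def
proof (rule topologically_amenable_selfmapI)
  fix T :: "'v topology" and act K F U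
  let ?S = "{f :: nat \<Rightarrow> nat. mono f}"
  assume "jointly_continuous_action ?S T act K" and K: "K \<noteq> {}" and F: "F \<subseteq> ?S"
    and U: "openin T U" "0 \<in> U"
  then interpret jointly_continuous_action ?S T act K by simp
  obtain x where x: "x \<in> K"
    using K by auto
  define p where "p k = act (\<lambda>_. k) x" for k
  have const: "(\<lambda>_. k) \<in> ?S" for k :: nat
    by (simp add: mono_def)
  have act_p: "act s (p k) = p (s k)" if "s \<in> ?S" for s k
    using act_comp[OF that const] by (simp add: p_def o_def)
  have p_in: "p k \<in> K" for k
    unfolding p_def by (rule act_in[OF const x])
  obtain V where V: "openin T V" "0 \<in> V" "\<And>a b. a \<in> V \<Longrightarrow> b \<in> V \<Longrightarrow> a - b \<in> U"
    using tvs_diff_neighbourhood[OF tvs U] by blast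
  have "\<exists>n. \<forall>k>n. p k - p j \<in> V" for j
  proof -
    obtain n where n: "\<And>s' x. s' \<in> ?S \<Longrightarrow> (\<And>i. i \<le> n \<Longrightarrow> s' i = j) \<Longrightarrow> x \<in> K \<Longrightarrow>
        act s' x - act (\<lambda>_. j) x \<in> V"
      using act_uniformly_close[OF const V(1,2), of j] by blast
    \<comment> \<open>Agrees with the constant \<open>j\<close> up to \<open>n\<close>, yet fixes
      every \<open>k\<close> beyond \<open>max n j\<close>.\<close>
    let ?r = "\<lambda>i. if i \<le> n then j else max i j"
    have r: "?r \<in> ?S"
      by (auto simp: mono_def)
    have "act ?r (p k) - act (\<lambda>_. j) (p k) \<in> V" for k
      by (rule n[OF r]) (simp_all add: p_in)
    then have *: "p (?r k) - p j \<in> V" for k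
      unfolding act_p[OF r] act_p[OF const] .
    have "p k - p j \<in> V" if "max n j < k" for k
      using *[of k] that by simp
    then show ?thesis by blast
  qed
  then obtain b where b: "\<And>j k. b j < k \<Longrightarrow> p k - p j \<in> V"
    by metis
  have "act s (p 0) - p 0 \<in> U" if "s \<in> F" for s
  proof -
    define k where "k = Suc (max (b 0) (b (s 0)))"
    have "(p k - p 0) - (p k - p (s 0)) \<in> U"
      by (intro V(3) b) (auto simp: k_def)
    then show ?thesis
      using act_p[of s 0] that F by auto
  qed
  with p_in show "\<exists>y\<in>K. \<forall>s\<in>F. act s y - y \<in> U"
    by blast
qed

section \<open>Surjections and strictly increasing sequences\<close>

text \<open>
  The order-preserving surjections \<open>t\<close> correspond to the strictly increasing \<open>e\<close> with \<open>e 0 = 0\<close>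
  through the Galois connection \<open>e n \<le> i \<longleftrightarrow> n \<le> t i\<close>; composition on the left
  of \<open>t\<close> becomes composition on the right of \<open>e\<close>.
\<close>

definition upper_adjoint :: "(nat \<Rightarrow> nat) \<Rightarrow> nat \<Rightarrow> nat" where
  "upper_adjoint e i = (GREATEST n. e n \<le> i)"

definition lower_adjoint :: "(nat \<Rightarrow> nat) \<Rightarrow> nat \<Rightarrow> nat" where
  "lower_adjoint t n = (LEAST i. n \<le> t i)"

text \<open>\<open>e 0 = 0\<close> makes the set under \<open>GREATEST\<close> nonempty, and
  \<open>n \<le> e n\<close> bounds it by \<open>i\<close>.\<close>

lemma le_upper_adjoint_iff:
  assumes "strict_mono e" "e 0 = 0"
  shows "n \<le> upper_adjoint e i \<longleftrightarrow> e n \<le> i"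
proof
  have bound: "\<And>n. e n \<le> i \<Longrightarrow> n \<le> i"
    using strict_mono_imp_increasing[OF assms(1)] order_trans by blast
  have "e (upper_adjoint e i) \<le> i"
    unfolding upper_adjoint_def by (rule GreatestI_nat[of _ 0 i]) (use assms bound in auto)
  then show "e n \<le> i" if "n \<le> upper_adjoint e i"
    using that assms(1) by (meson order_trans strict_mono_less_eq)
  show "n \<le> upper_adjoint e i" if "e n \<le> i"
    unfolding upper_adjoint_def by (rule Greatest_le_nat[of _ n i]) (use that bound in auto)
qed

lemma lower_adjoint_le_iff:
  assumes "mono t" "surj t"
  shows "lower_adjoint t n \<le> i \<longleftrightarrow> n \<le> t i"
proof
  obtain j where "n \<le> t j"
    using assms(2) by (metis order_refl surjD)
  then have "n \<le> t (lower_adjoint t n)"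
    unfolding lower_adjoint_def by (rule LeastI)
  then show "n \<le> t i" if "lower_adjoint t n \<le> i"
    using that assms(1) by (meson monoD order_trans)
  show "lower_adjoint t n \<le> i" if "n \<le> t i"
    unfolding lower_adjoint_def using that by (rule Least_le)
qed

lemma upper_adjoint_apply:
  assumes "strict_mono e" "e 0 = 0"
  shows "upper_adjoint e (e n) = n"
  by (rule antisym) (use le_upper_adjoint_iff[OF assms] strict_mono_less_eq[OF assms(1)] in blast)+

lemma mono_upper_adjoint:
  assumes "strict_mono e" "e 0 = 0"
  shows "mono (upper_adjoint e)"
proof (rule monoI)
  fix i j :: nat
  assume "i \<le> j"
  moreover have "e (upper_adjoint e i) \<le> i"
    using le_upper_adjoint_iff[OF assms] by blast
  ultimately show "upper_adjoint e i \<le> upper_adjoint e j"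
    using le_upper_adjoint_iff[OF assms] order_trans by blast
qed

lemma surj_upper_adjoint:
  assumes "strict_mono e" "e 0 = 0"
  shows "surj (upper_adjoint e)"
  by (rule surjI[of _ e]) (rule upper_adjoint_apply[OF assms])

lemma apply_lower_adjoint:
  assumes "mono t" "surj t"
  shows "t (lower_adjoint t n) = n"
proof (rule antisym)
  obtain i where i: "t i = n"
    using assms(2) by (metis surjD)
  then have "lower_adjoint t n \<le> i"
    by (simp add: lower_adjoint_le_iff[OF assms])
  then show "t (lower_adjoint t n) \<le> n"
    using monoD[OF assms(1)] i by metis
  show "n \<le> t (lower_adjoint t n)"
    using lower_adjoint_le_iff[OF assms] by blast
qed

lemma strict_mono_lower_adjoint:
  assumes "mono t" "surj t"
  shows "strict_mono (lower_adjoint t)"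
  unfolding strict_mono_Suc_iff
proof
  fix n
  have "\<not> Suc n \<le> t (lower_adjoint t n)"
    by (simp add: apply_lower_adjoint[OF assms])
  then show "lower_adjoint t n < lower_adjoint t (Suc n)"
    using lower_adjoint_le_iff[OF assms] by (meson not_le)
qed

lemma lower_adjoint_0 [simp]: "lower_adjoint t 0 = 0"
  by (simp add: lower_adjoint_def)

lemma lower_adjoint_upper_adjoint_comp:
  assumes "strict_mono e" "e 0 = 0"
  shows "lower_adjoint (upper_adjoint e \<circ> t) = lower_adjoint t \<circ> e"
  by (simp add: fun_eq_iff lower_adjoint_def le_upper_adjoint_iff[OF assms])

text \<open>Both sides have the same lower bounds \<open>k\<close>, those with
  \<open>e (lower_adjoint s k) \<le> i\<close>.\<close>

lemma comp_upper_adjoint: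
  assumes "mono s" "surj s" "strict_mono e" "e 0 = 0"
  shows "s \<circ> upper_adjoint e = upper_adjoint (e \<circ> lower_adjoint s)"
proof
  fix i
  have e': "strict_mono (e \<circ> lower_adjoint s)" "(e \<circ> lower_adjoint s) 0 = 0"
    using assms strict_mono_lower_adjoint by (auto simp: strict_mono_def)
  have "k \<le> (s \<circ> upper_adjoint e) i \<longleftrightarrow> k \<le> upper_adjoint (e \<circ> lower_adjoint s) i" for k
    by (simp only: le_upper_adjoint_iff[OF e'])
      (simp add: le_upper_adjoint_iff[OF assms(3,4)] lower_adjoint_le_iff[OF assms(1,2), symmetric])
  then show "(s \<circ> upper_adjoint e) i = upper_adjoint (e \<circ> lower_adjoint s) i"
    by (meson antisym order_refl)
qed

text \<open>For a finite nonempty \<open>B\<close> of positive numbers, this is the surjection whose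
  lower adjoint lists 0, then \<open>B\<close> in increasing order, then every number after
  \<open>Max B\<close>.\<close>

definition prefix_surjection :: "nat set \<Rightarrow> nat \<Rightarrow> nat" where
  "prefix_surjection B i = card (B \<inter> {..i}) + (i - Max B)"

text \<open>The factor \<open>v\<close> sees only the first \<open>n\<close> positive-index values
  of \<open>X\<close>; all later ones go into \<open>r\<close>, which fixes \<open>{..n}\<close> and
  so is close to the identity.\<close>

lemma upper_adjoint_factor:
  assumes X: "strict_mono X" "X 0 = 0" and n: "0 < n"
  defines "v \<equiv> prefix_surjection (X ` {1..n})"
  shows "mono v" and "surj v"
    and "\<exists>r. mono r \<and> surj r \<and> (\<forall>k\<le>n. r k = k) \<and> r \<circ> v = upper_adjoint X"
proof -
  note le = le_upper_adjoint_iff[OF X]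
  have X_le: "X i \<le> X j \<longleftrightarrow> i \<le> j" for i j
    by (rule strict_mono_less_eq[OF X(1)])
  have Max: "Max (X ` {1..n}) = X n"
    by (rule Max_eqI) (use n X_le in auto)
  have v: "v i = min n (upper_adjoint X i) + (i - X n)" for i
  proof -
    have "X ` {1..n} \<inter> {..i} = X ` {1..min n (upper_adjoint X i)}"
      using le by auto
    then show ?thesis
      unfolding v_def prefix_surjection_def Max
      by (simp add: card_image strict_mono_imp_inj_on[OF X(1)] inj_on_subset)
  qed
  show "mono v"
    using monoD[OF mono_upper_adjoint[OF X]]
    by (intro monoI) (auto simp: v intro!: add_mono diff_le_mono min.mono)
  show "surj v"
  proof (rule surjI[of _ "\<lambda>m. if m \<le> n then X m else m - n + X n"])
    fix m
    show "v (if m \<le> n then X m else m - n + X n) = m"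
      using le[of n "m - n + X n"] X_le[of m n] by (auto simp: v upper_adjoint_apply[OF X])
  qed
  \<comment> \<open>Beyond \<open>X n\<close> the map \<open>v\<close> is a translation, undone by
    \<open>k - n + X n\<close>; up to \<open>X n\<close> it already equals
    \<open>upper_adjoint X\<close>.\<close>
  define r where "r k = (if k \<le> n then k else upper_adjoint X (k - n + X n))" for k
  have "mono r"
  proof (rule monoI)
    fix j k :: nat
    assume "j \<le> k"
    then show "r j \<le> r k"
      using le[of n "k - n + X n"] monoD[OF mono_upper_adjoint[OF X], of "j - n + X n" "k - n + X n"]
      by (auto simp: r_def)
  qed
  moreover have "surj r"
  proof (rule surjI[of _ "\<lambda>m. if m \<le> n then m else X m - X n + n"])
    fix m
    show "r (if m \<le> n then m else X m - X n + n) = m"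
      using X_le[of m n] by (auto simp: r_def upper_adjoint_apply[OF X])
  qed
  moreover have "r \<circ> v = upper_adjoint X"
  proof
    fix i
    show "(r \<circ> v) i = upper_adjoint X i"
      using le[of n i] le[of "Suc n" i] X_le[of "Suc n" n] X_le[of n "Suc n"] by (auto simp: r_def v min_def)
  qed
  ultimately show "\<exists>r. mono r \<and> surj r \<and> (\<forall>k\<le>n. r k = k) \<and> r \<circ> v = upper_adjoint X"
    by (intro exI[of _ r]) (simp add: r_def)
qed

context jointly_continuous_action
begin

lemma finite_net:
  assumes W: "openin T W" "0 \<in> W"
  obtains D where "finite D" "\<And>z. z \<in> K \<Longrightarrow> \<exists>d\<in>D. z - d \<in> W"
proof -
  have "openin T {z. z - d \<in> W}" for d
    by (rule openin_tvs_vimage[OF tvs tvs_continuous_diff[OF tvs] W(1)])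
      (use tvs in \<open>auto simp: hausdorff_tvs_def\<close>)
  then have "\<exists>\<F>. finite \<F> \<and> \<F> \<subseteq> (\<lambda>d. {z. z - d \<in> W}) ` K \<and> K \<subseteq> \<Union> \<F>"
    using compact W(2) by (intro compactinD) auto
  then obtain D where "finite D" "K \<subseteq> (\<Union>d\<in>D. {z. z - d \<in> W})"
    by (metis finite_subset_image)
  then show thesis
    by (intro that[of D]) auto
qed

end

text \<open>
  Up to a map close to the identity, an element \<open>s \<circ> upper_adjoint e\<close> depends only on
  the first \<open>n\<close> values of its lower adjoint, which all lie in the range of \<open>e\<close>. Ramsey's
  theorem provides an \<open>e\<close> for which this finite set of values is irrelevant.
\<close>

lemma Epi_le_almost_fixed:
  fixes T :: "'v::real_vector topology"
  defines "S \<equiv> {f :: nat \<Rightarrow> nat. mono f \<and> surj f}"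
  assumes "jointly_continuous_action S T act K" and "K \<noteq> {}" and U: "openin T U" "0 \<in> U"
  shows "\<exists>y\<in>K. \<forall>s\<in>S. act s y - y \<in> U"
proof -
  interpret jointly_continuous_action S T act K
    by (rule assms)
  obtain x where x: "x \<in> K"
    using \<open>K \<noteq> {}\<close> by auto
  have id: "id \<in> S"
    by (simp add: S_def mono_def)
  have upper: "upper_adjoint e \<in> S" if "strict_mono e" "e 0 = 0" for e
    using that by (simp add: S_def mono_upper_adjoint surj_upper_adjoint)
  obtain V where V: "openin T V" "0 \<in> V" "\<And>a b. a \<in> V \<Longrightarrow> b \<in> V \<Longrightarrow> a - b \<in> U"
    using tvs_diff_neighbourhood[OF tvs U] by blast
  obtain W where W: "openin T W" "0 \<in> W" "\<And>a b. a \<in> W \<Longrightarrow> b \<in> W \<Longrightarrow> a - b \<in> V"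
    using tvs_diff_neighbourhood[OF tvs V(1,2)] by blast
  obtain n0 where n0: "\<And>s' x. s' \<in> S \<Longrightarrow> (\<And>i. i \<le> n0 \<Longrightarrow> s' i = id i) \<Longrightarrow> x \<in> K \<Longrightarrow>
      act s' x - act id x \<in> W"
    using act_uniformly_close[OF id W(1,2)] by blast
  \<comment> \<open>The successor makes \<open>n\<close> positive, as the factorization
    requires.\<close>
  define n where "n = Suc n0"
  obtain D where D: "finite D" "\<And>z. z \<in> K \<Longrightarrow> \<exists>d\<in>D. z - d \<in> W"
    using finite_net[OF W(1,2)] by blast
  obtain g where g: "bij_betw g D {..<card D}"
    using ex_bij_betw_finite_nat[OF D(1)] by (auto simp: atLeast0LessThan)
  have "0 < card D"
    using D x by (auto simp: card_gt_0_iff)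
  \<comment> \<open>Sets are coloured by a net point \<open>W\<close>-close to the orbit point of
    their prefix surjection. The default colour 0 is legitimate because \<open>D\<close> is
    nonempty.\<close>
  define near where "near B = (SOME d. d \<in> D \<and> act (prefix_surjection B) x - d \<in> W)" for B
  have near: "near B \<in> D \<and> act (prefix_surjection B) x - near B \<in> W"
    if "prefix_surjection B \<in> S" for B
    unfolding near_def by (rule someI_ex) (use D(2) act_in[OF that x] in blast)
  define colour where "colour B = (if prefix_surjection B \<in> S then g (near B) else 0)" for B
  have "colour B < card D" for B
    using near[of B] bij_betwE[OF g] \<open>0 < card D\<close> by (auto simp: colour_def)
  then obtain H c where H: "H \<subseteq> {1..}" "infinite H"
      "\<And>B. B \<subseteq> H \<Longrightarrow> finite B \<Longrightarrow> card B = n \<Longrightarrow> colour B = c"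
    using Ramsey[of "{1..}" n colour "card D"] infinite_Ici[of "1 :: nat"] by metis
  \<comment> \<open>Ramsey was applied to the positive numbers, so 0 can be prepended to
    \<open>H\<close>.\<close>
  define e where "e = enumerate (insert 0 H)"
  have e: "strict_mono e" "e 0 = 0"
    using H(2) by (auto simp: e_def strict_mono_enumerate enumerate_0)
  have e_in: "e k \<in> H" if "0 < k" for k
  proof -
    have "e k \<in> insert 0 H"
      unfolding e_def using H(2) by (intro enumerate_in_set) simp
    moreover have "e k \<noteq> 0"
      using strict_monoD[OF e(1) that] e(2) by simp
    ultimately show ?thesis by simp
  qed
  define d where "d = inv_into D g c"
  let ?y = "act (upper_adjoint e) x"
  \<comment> \<open>The centre \<open>d\<close> is the same for all \<open>s\<close>;
    \<open>w\<close> is the error from \<open>r\<close> being near the identity and \<open>z\<close>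
    the error from the net. Comparing \<open>s\<close> with \<open>id\<close> cancels
    \<open>d\<close>.\<close>
  have close: "\<exists>w\<in>W. \<exists>z\<in>W. act s ?y = w + z + d" if s: "s \<in> S" for s
  proof -
    define X where "X = e \<circ> lower_adjoint s"
    have s': "mono s" "surj s"
      using s by (auto simp: S_def)
    have X: "strict_mono X" "X 0 = 0"
      using e strict_mono_lower_adjoint[OF s'] by (auto simp: X_def strict_mono_def)
    define B where "B = X ` {1..n}"
    have "lower_adjoint s k > 0" if "0 < k" for k
      using strict_monoD[OF strict_mono_lower_adjoint[OF s'] that] by simp
    then have "B \<subseteq> H"
      using e_in by (auto simp: B_def X_def)
    moreover have "card B = n"
      unfolding B_def using X(1) by (simp add: card_image strict_mono_imp_inj_on inj_on_subset)
    ultimately have "colour B = c"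
      using H(3) by (simp add: B_def)
    have "0 < n"
      by (simp add: n_def)
    note factor = upper_adjoint_factor[OF X this, folded B_def]
    have pB: "prefix_surjection B \<in> S"
      using factor by (simp add: S_def)
    have "g (near B) = c"
      using \<open>colour B = c\<close> pB by (simp add: colour_def)
    then have near_d: "near B = d"
      using near[OF pB] bij_betw_imp_inj_on[OF g] by (auto simp: d_def)
    obtain r where r: "r \<in> S" "\<And>k. k \<le> n \<Longrightarrow> r k = k" "r \<circ> prefix_surjection B = upper_adjoint X"
      using factor(3) by (auto simp: S_def)
    let ?z = "act (prefix_surjection B) x"
    have "act r ?z - act id ?z \<in> W"
      by (rule n0[OF r(1)]) (simp_all add: r(2) n_def act_in[OF pB x])
    moreover have "act s ?y = act r ?z"
      using r(3) comp_upper_adjoint[OF s' e]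
      by (simp add: act_comp[OF s upper[OF e], symmetric] act_comp[OF r(1) pB, symmetric] X_def)
    moreover have "?z - d \<in> W"
      using near[OF pB] near_d by simp
    ultimately show ?thesis
      by (intro bexI[of _ "act r ?z - ?z"] bexI[of _ "?z - d"]) (simp_all add: act_id)
  qed
  have "act s ?y - ?y \<in> U" if "s \<in> S" for s
  proof -
    obtain w z where wz: "w \<in> W" "z \<in> W" "act s ?y = w + z + d"
      using close[OF \<open>s \<in> S\<close>] by blast
    obtain w' z' where wz': "w' \<in> W" "z' \<in> W" "?y = w' + z' + d"
      using close[OF id] by (auto simp: act_id)
    have "(w - w') - (z' - z) \<in> U"
      by (intro V(3) W(3) wz wz')
    also have "(w - w') - (z' - z) = act s ?y - ?y"
      by (simp only: wz(3)) (simp add: wz'(3))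
    finally show ?thesis .
  qed
  then show ?thesis
    using act_in[OF upper[OF e] x] by blast
qed

lemma topologically_amenable_Epi_le:
  "topologically_amenable TYPE('v::real_vector) Epi_le (pointwise_topology Epi_le)"
  unfolding Epi_le_def
proof (rule topologically_amenable_selfmapI)
  fix T :: "'v topology" and act K U and F :: "(nat \<Rightarrow> nat) set"
  assume "jointly_continuous_action {f. mono f \<and> surj f} T act K" "K \<noteq> {}"
    "F \<subseteq> {f. mono f \<and> surj f}" "openin T U" "0 \<in> U"
  then show "\<exists>y\<in>K. \<forall>s\<in>F. act s y - y \<in> U"
    using Epi_le_almost_fixed[of T act K U] by blast
qed

section \<open>Non-amenability\<close>

text \<open>A left-invariant mean restricted to indicators. Sets of arbitrary maps stand for their
  traces on \<open>S\<close>; this is what the last assumption says.\<close>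

locale invariant_measure =
  fixes S :: "(nat \<Rightarrow> nat) set" and \<mu> :: "(nat \<Rightarrow> nat) set \<Rightarrow> real"
  assumes nonneg: "0 \<le> \<mu> A" and total: "\<mu> UNIV = 1"
    and additive: "A \<inter> B = {} \<Longrightarrow> \<mu> (A \<union> B) = \<mu> A + \<mu> B"
    and invariant: "s \<in> S \<Longrightarrow> \<mu> {t. s \<circ> t \<in> A} = \<mu> A"
    and supported: "A \<inter> S = B \<inter> S \<Longrightarrow> \<mu> A = \<mu> B"
begin

lemma measure_mono:
  assumes "A \<inter> S \<subseteq> B"
  shows "\<mu> A \<le> \<mu> B"
proof -
  have "\<mu> A = \<mu> (A \<inter> S)"
    by (rule supported) auto
  also have "\<dots> \<le> \<mu> (A \<inter> S) + \<mu> (B - A \<inter> S)"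
    using nonneg by simp
  also have "\<dots> = \<mu> B"
    using additive[of "A \<inter> S" "B - A \<inter> S"] assms by (simp add: Un_absorb1)
  finally show ?thesis .
qed

lemma measure_compl: "\<mu> (- A) = 1 - \<mu> A"
  using additive[of A "- A"] total by simp

end

text \<open>One direction of Day's theorem: translation acts on the compact convex set of means, and
  a fixed point is an invariant mean.\<close>

lemma amenable_imp_invariant_measure:
  assumes amenable: "amenable TYPE(day_space) (selfmap_monoid S)"
    and monoid: "monoid (selfmap_monoid S)"
  shows "\<exists>\<mu>. invariant_measure S \<mu>"
proof -
  have id: "id \<in> S" and comp: "\<And>s t. s \<in> S \<Longrightarrow> t \<in> S \<Longrightarrow> s \<circ> t \<in> S"
    using monoid.one_closed[OF monoid] monoid.m_closed[OF monoid] by simp_all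
  let ?T = "product_topology (\<lambda>_::(nat \<Rightarrow> nat) \<Rightarrow> real. euclideanreal) UNIV"
  define act :: "(nat \<Rightarrow> nat) \<Rightarrow> day_space \<Rightarrow> day_space" where "act s m f = m (\<lambda>t. f (s \<circ> t))" for s m f
  \<comment> \<open>Every function, even an unbounded one, gets a value in \<open>[0, 1]\<close>, so
    \<open>K\<close> is a closed subset of a cube. Additivity is imposed only where the sum stays in
    \<open>[0, 1]\<close>, which covers indicators of disjoint sets.\<close>
  define K :: "day_space set" where
    "K = {m. (\<forall>f. 0 \<le> m f \<and> m f \<le> 1) \<and> m (\<lambda>_. 1) = 1 \<and>
      (\<forall>f g. (\<forall>t. 0 \<le> f t \<and> 0 \<le> g t \<and> f t + g t \<le> 1) \<longrightarrow> m (\<lambda>t. f t + g t) = m f + m g) \<and>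
      (\<forall>f g. (\<forall>t\<in>S. f t = g t) \<longrightarrow> m f = m g)}"
  have coord: "continuous_on UNIV (\<lambda>m::day_space. m f)" for f
    by (rule continuous_on_product_coordinates)
  have "closed K"
    unfolding K_def
    by (intro closed_Collect_conj closed_Collect_all closed_Collect_imp closed_Collect_eq
        closed_Collect_le continuous_on_add continuous_on_const coord open_Collect_const)
  then have "closedin ?T K"
    by (simp add: euclidean_product_topology)
  moreover have "compactin ?T (PiE UNIV (\<lambda>_. {0..1}))"
    by (simp add: compactin_PiE)
  moreover have "K \<subseteq> PiE UNIV (\<lambda>_. {0..1})"
    by (auto simp: K_def)
  ultimately have "compactin ?T K"
    using closed_compactin by blast
  moreover have "convex K"
    unfolding convex_def
  proof (intro ballI allI impI)
    fix m m' :: day_space and u v :: real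
    assume m: "m \<in> K" "m' \<in> K" and uv: "0 \<le> u" "0 \<le> v" "u + v = 1"
    have "u * m f + v * m' f \<le> 1" for f
      using convex_bound_le[of "m f" 1 "m' f" u v] m uv by (simp add: K_def)
    moreover have "\<forall>f g. (\<forall>t\<in>S. f t = g t) \<longrightarrow> m f = m g \<and> m' f = m' g"
      using m unfolding K_def by blast
    then have "\<forall>f g. (\<forall>t\<in>S. f t = g t) \<longrightarrow> u * m f + v * m' f = u * m g + v * m' g"
      by metis
    ultimately show "u *\<^sub>R m + v *\<^sub>R m' \<in> K"
      using m uv by (simp add: K_def algebra_simps)
  qed
  moreover have "act id = id"
    by (simp add: act_def fun_eq_iff)
  moreover have "act (s \<circ> t) = act s \<circ> act t" for s t
    by (simp add: act_def fun_eq_iff comp_assoc)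
  moreover have "continuous_map ?T ?T (act s)" for s
    unfolding continuous_map_componentwise_UNIV act_def
    by (intro allI continuous_map_product_projection) simp
  moreover have "affine_map (act s)" for s
    by (simp add: affine_map_def act_def fun_eq_iff)
  moreover have "act s m \<in> K" if "s \<in> S" "m \<in> K" for s m
  proof -
    have agree: "\<And>f g. \<forall>t\<in>S. f t = g t \<Longrightarrow> m f = m g"
      using \<open>m \<in> K\<close> unfolding K_def by blast
    have "m (\<lambda>t. f (s \<circ> t)) = m (\<lambda>t. g (s \<circ> t))" if "\<forall>t\<in>S. f t = g t" for f g
      by (rule agree) (use that comp[OF \<open>s \<in> S\<close>] in auto)
    then show ?thesis
      using \<open>m \<in> K\<close> by (simp add: K_def act_def)
  qed
  ultimately have "convex_compact_space (selfmap_monoid S) ?T act K"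
    by (auto simp: convex_compact_space_def hausdorff_tvs_product)
  \<comment> \<open>Nonemptiness: evaluation at \<open>id\<close>, clamped to
    \<open>[0, 1]\<close>.\<close>
  moreover have "(\<lambda>f. max 0 (min 1 (f id))) \<in> K"
    unfolding K_def
  proof (intro CollectI conjI allI impI)
    fix f g :: "(nat \<Rightarrow> nat) \<Rightarrow> real"
    assume "\<forall>t. 0 \<le> f t \<and> 0 \<le> g t \<and> f t + g t \<le> 1"
    from spec[OF this, of id]
    show "max 0 (min 1 (f id + g id)) = max 0 (min 1 (f id)) + max 0 (min 1 (g id))"
      by simp
  qed (use id in auto)
  ultimately have "has_fixed_point (selfmap_monoid S) act K"
    by (intro amenable[unfolded amenable_def, rule_format, of ?T]) auto
  then obtain m where m: "m \<in> K" "\<And>s. s \<in> S \<Longrightarrow> act s m = m"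
    by (auto simp: has_fixed_point_def)
  have "invariant_measure S (\<lambda>A. m (indicator A))"
  proof
    fix A B :: "(nat \<Rightarrow> nat) set"
    assume "A \<inter> B = {}"
    then have "indicator (A \<union> B) = (\<lambda>t. indicator A t + indicator B t :: real)"
      and "\<forall>t. indicator A t + indicator B t \<le> (1 :: real)"
      by (auto simp: fun_eq_iff indicator_def)
    then show "m (indicator (A \<union> B)) = m (indicator A) + m (indicator B)"
      using m(1) by (simp add: K_def)
  next
    fix s :: "nat \<Rightarrow> nat" and A :: "(nat \<Rightarrow> nat) set"
    assume "s \<in> S"
    have "indicator {t. s \<circ> t \<in> A} = (\<lambda>t. indicator A (s \<circ> t) :: real)"
      by (auto simp: fun_eq_iff indicator_def)
    then show "m (indicator {t. s \<circ> t \<in> A}) = m (indicator A)"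
      using fun_cong[OF m(2)[OF \<open>s \<in> S\<close>], of "indicator A"] by (simp add: act_def)
  next
    fix A B :: "(nat \<Rightarrow> nat) set"
    assume "A \<inter> S = B \<inter> S"
    then have "\<forall>t\<in>S. indicator A t = (indicator B t :: real)"
      by (auto simp: indicator_def)
    then show "m (indicator A) = m (indicator B)"
      using m(1) unfolding K_def by blast
  qed (use m(1) in \<open>auto simp: K_def indicator_def\<close>)
  then show ?thesis
    by blast
qed

text \<open>Every \<open>s \<circ> t\<close> has range inside \<open>range s\<close>, so by
  invariance the maps with this property have measure 1; disjoint ranges give two disjoint sets of
  measure 1.\<close>

lemma not_amenable_if_disjoint_right_ideals:
  assumes monoid: "monoid (selfmap_monoid S)"
    and ab: "a \<in> S" "b \<in> S" "range a \<inter> range b = {}"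
  shows "\<not> amenable TYPE(day_space) (selfmap_monoid S)"
proof
  assume "amenable TYPE(day_space) (selfmap_monoid S)"
  then obtain \<mu> where "invariant_measure S \<mu>"
    using amenable_imp_invariant_measure[OF _ monoid] by blast
  then interpret invariant_measure S \<mu> .
  let ?R = "\<lambda>s. {t. range t \<subseteq> range s}"
  have one: "\<mu> (?R s) = 1" if "s \<in> S" for s
  proof -
    have "\<mu> (?R s) = \<mu> {t. s \<circ> t \<in> ?R s}"
      by (rule invariant[OF that, symmetric])
    also have "{t. s \<circ> t \<in> ?R s} = UNIV"
      by auto
    finally show ?thesis
      unfolding total .
  qed
  have disjoint: "?R a \<inter> ?R b = {}"
    using ab(3) by blast
  have "\<mu> (?R a \<union> ?R b) = 2"
    unfolding additive[OF disjoint] one[OF ab(1)] one[OF ab(2)] by simp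
  then show False
    using measure_compl[of "?R a \<union> ?R b"] nonneg[of "- (?R a \<union> ?R b)"] by simp
qed

lemma not_amenable_with_embeddings:
  assumes "monoid (selfmap_monoid S)" and "{f. mono f \<and> inj f} \<subseteq> S"
  shows "\<not> amenable TYPE(day_space) (selfmap_monoid S)"
proof (rule not_amenable_if_disjoint_right_ideals[OF assms(1)])
  show "(\<lambda>n. 2 * n) \<in> S" "(\<lambda>n. 2 * n + 1) \<in> S"
    using assms(2) by (auto simp: mono_def inj_def)
  show "range (\<lambda>n::nat. 2 * n) \<inter> range (\<lambda>n. 2 * n + 1) = {}"
    by auto presburger
qed

subsection \<open>Ping-pong on dyadic rationals modulo powers of four\<close>

text \<open>
  Positive integers up to multiplication by powers of 4 form a circle; \<open>stretch\<close> and doubling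
  induce homeomorphisms of it. Doubling is half a turn and \<open>stretch\<close> maps the complement of the
  arc \<open>[3/2, 2)\<close> onto the arc \<open>[1, 3/2)\<close>. All slopes of \<open>stretch\<close> are powers of 2, so that it acts
  bijectively on the dyadic points.
\<close>

definition stretch :: "nat \<Rightarrow> nat" where
  "stretch n =
     (let K = 4 ^ (LEAST k. n < 8 * 4 ^ k) in
      if n < 2 then 5 * n else if n < 6 * K then 2 * n + 12 * K
      else if n < 7 * K then 8 * n - 24 * K else 32 * n - 192 * K)"

text \<open>A block is a fundamental domain for multiplication by 4, on which the
  \<open>LEAST\<close> exponent is constant.\<close>

lemma stretch_block:
  assumes "2 * 4 ^ k \<le> n" "n < 8 * 4 ^ k"
  shows "stretch n = (if n < 6 * 4 ^ k then 2 * n + 12 * 4 ^ k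
    else if n < 7 * 4 ^ k then 8 * n - 24 * 4 ^ k else 32 * n - 192 * 4 ^ k)"
proof -
  have "(LEAST k. n < 8 * 4 ^ k) = k"
  proof (rule Least_equality)
    fix j
    assume "n < 8 * 4 ^ j"
    show "k \<le> j"
    proof (rule ccontr)
      assume "\<not> k \<le> j"
      then have "(4 :: nat) ^ Suc j \<le> 4 ^ k"
        by (intro power_increasing) auto
      with \<open>n < 8 * 4 ^ j\<close> assms(1) show False
        by simp
    qed
  qed (rule assms)
  moreover have "2 \<le> n"
    using assms(1) one_le_power[of "4::nat" k] by linarith
  ultimately show ?thesis
    by (simp add: stretch_def)
qed

lemma obtain_block:
  fixes n :: nat
  assumes "2 \<le> n"
  obtains k where "2 * 4 ^ k \<le> n" "n < 8 * 4 ^ k"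
proof -
  define k where "k = (LEAST k. n < 8 * 4 ^ k)"
  have "n < 8 * 4 ^ n"
    using less_exp[of n] power_mono[of 2 "4::nat" n] by linarith
  then have "n < 8 * 4 ^ k"
    unfolding k_def by (rule LeastI)
  moreover have "2 * 4 ^ k \<le> n"
  proof (cases k)
    case (Suc j)
    then have "\<not> n < 8 * 4 ^ j"
      unfolding k_def by (metis lessI not_less_Least)
    then show ?thesis
      using Suc by simp
  qed (use assms in simp)
  ultimately show thesis
    using that by blast
qed

lemma stretch_0 [simp]: "stretch 0 = 0" and stretch_1 [simp]: "stretch (Suc 0) = 5"
  by (simp_all add: stretch_def)

text \<open>The linear pieces have positive slopes and match at the breakpoints, also from one block
  to the next.\<close>

lemma strict_mono_stretch: "strict_mono stretch"
  unfolding strict_mono_Suc_iff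
proof
  fix n :: nat
  consider "n = 0" | "n = 1" | "2 \<le> n" by linarith
  then show "stretch n < stretch (Suc n)"
  proof cases
    case 3
    then obtain k where k: "2 * 4 ^ k \<le> n" "n < 8 * 4 ^ k"
      by (rule obtain_block)
    show ?thesis
    proof (cases "Suc n < 8 * 4 ^ k")
      case True
      then show ?thesis
        using k by (auto simp: stretch_block[of k])
    next
      case False
      then have "Suc n = 8 * 4 ^ k"
        using k by simp
      then show ?thesis
        using k stretch_block[of k n] stretch_block[of "Suc k" "Suc n"] by simp
    qed
  qed (use stretch_block[of 0 2] in \<open>simp_all add: numeral_2_eq_2\<close>)
qed

text \<open>The formula is homogeneous in \<open>n\<close> and the block size. The number 1 lies
  below the first block; its value 5 is forced by \<open>stretch 4 = 20\<close>.\<close>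

lemma stretch_mult_4: "stretch (4 * n) = 4 * stretch n"
proof -
  consider "n = 0" | "n = 1" | "2 \<le> n" by linarith
  then show ?thesis
  proof cases
    case 3
    then obtain k where k: "2 * 4 ^ k \<le> n" "n < 8 * 4 ^ k"
      by (rule obtain_block)
    then show ?thesis
      using stretch_block[of k n] stretch_block[of "Suc k" "4 * n"] by auto
  qed (use stretch_block[of 0 4] in simp_all)
qed

text \<open>Surjectivity on the circle, as \<open>64 = 4 ^ 3\<close>. This factor makes the inverses
  of the pieces of slopes 2, 8 and 32 integral; the three cases are the images of these
  pieces.\<close>

lemma stretch_surj:
  assumes "0 < n"
  shows "\<exists>m>0. 64 * n = stretch m"
proof -
  obtain k where k: "2 * 4 ^ k \<le> 8 * n" "8 * n < 8 * 4 ^ k"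
    using assms obtain_block[of "8 * n"] by auto
  let ?K = "4 ^ k :: nat"
  have K: "0 < ?K" by simp
  consider "8 * n < 3 * ?K" | "3 * ?K \<le> 8 * n" "2 * n < ?K" | "?K \<le> 2 * n"
    by linarith
  then show ?thesis
  proof cases
    case 1
    have "stretch (32 * n - 6 * ?K) = 64 * n"
      using 1 k by (subst stretch_block[of k]) auto
    then show ?thesis
      using 1 k K by (intro exI[of _ "32 * n - 6 * ?K"]) auto
  next
    case 2
    have "stretch (8 * n + 3 * ?K) = 64 * n"
      using 2 k by (subst stretch_block[of k]) auto
    then show ?thesis
      using 2 k K by (intro exI[of _ "8 * n + 3 * ?K"]) auto
  next
    case 3
    have "stretch (2 * n + 6 * ?K) = 64 * n"
      using 3 k by (subst stretch_block[of k]) auto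
    then show ?thesis
      using 3 k K by (intro exI[of _ "2 * n + 6 * ?K"]) auto
  qed
qed

definition arc1 :: "nat set" where
  "arc1 = {n. \<exists>k. 4 ^ k \<le> n \<and> 2 * n < 3 * 4 ^ k}"

definition arc2 :: "nat set" where
  "arc2 = {n. \<exists>k. 3 * 4 ^ k \<le> 2 * n \<and> n < 2 * 4 ^ k}"

lemma power_4_less_iff: "(4::nat) ^ j < 2 * 4 ^ k \<longleftrightarrow> j \<le> k"
proof
  show "j \<le> k" if "(4::nat) ^ j < 2 * 4 ^ k"
  proof (rule ccontr)
    assume "\<not> j \<le> k"
    then have "(4::nat) ^ Suc k \<le> 4 ^ j"
      by (intro power_increasing) auto
    with that show False by simp
  qed
  show "(4::nat) ^ j < 2 * 4 ^ k" if "j \<le> k"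
    using power_increasing[OF that, of "4::nat"] zero_less_power[of "4::nat" k] by linarith
qed

lemma arc1_arc2_disjoint: "arc1 \<inter> arc2 = {}"
proof -
  have False if n: "4 ^ k \<le> n" "2 * n < 3 * 4 ^ k" "3 * 4 ^ j \<le> 2 * n" "n < 2 * 4 ^ j"
    for n k j :: nat
  proof -
    have "(4::nat) ^ k < 2 * 4 ^ j"
      using n by linarith
    then have "k \<le> j"
      by (simp add: power_4_less_iff)
    then have "(4::nat) ^ k \<le> 4 ^ j"
      by (intro power_increasing) auto
    then show False
      using n by linarith
  qed
  then show ?thesis
    by (auto simp: arc1_def arc2_def)
qed

text \<open>The arcs together form the half circle \<open>[1, 2)\<close>, which doubling moves to
  \<open>[2, 4)\<close>.\<close>

lemma double_notin_arcs:
  assumes "n \<in> arc1 \<union> arc2"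
  shows "2 * n \<notin> arc1 \<union> arc2"
proof
  have arcs: "\<exists>k. 4 ^ k \<le> m \<and> m < 2 * 4 ^ k" if "m \<in> arc1 \<union> arc2" for m
  proof -
    have "\<exists>k. 4 ^ k \<le> m \<and> 2 * m < 3 * 4 ^ k \<or> 3 * 4 ^ k \<le> 2 * m \<and> m < 2 * 4 ^ k"
      using that by (auto simp: arc1_def arc2_def)
    then obtain k where "4 ^ k \<le> m \<and> 2 * m < 3 * 4 ^ k \<or> 3 * 4 ^ k \<le> 2 * m \<and> m < 2 * 4 ^ k" ..
    moreover have "(0::nat) < 4 ^ k" by simp
    ultimately have "4 ^ k \<le> m \<and> m < 2 * 4 ^ k" by linarith
    then show ?thesis ..
  qed
  assume "2 * n \<in> arc1 \<union> arc2"
  with assms obtain j k where *: "4 ^ k \<le> n" "n < 2 * 4 ^ k" "4 ^ j \<le> 2 * n" "2 * n < 2 * 4 ^ j"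
    using arcs by meson
  then have "(4::nat) ^ k < 2 * 4 ^ j" "4 ^ j < 4 * (4::nat) ^ k"
    by linarith+
  then have "k \<le> j" "j < Suc k"
    using power_strict_increasing_iff[of "4::nat" j "Suc k"] by (simp_all add: power_4_less_iff)
  then have "j = k"
    by simp
  then show False
    using * by simp
qed

text \<open>With \<open>K = 4 ^ k\<close>, a block meets \<open>arc2\<close> in
  \<open>[6K, 8K)\<close>; the rest \<open>[2K, 6K)\<close> is mapped into
  \<open>[16K, 24K)\<close>, which is in \<open>arc1\<close> with exponent
  \<open>k + 2\<close>.\<close>

lemma stretch_in_arc1:
  assumes "0 < n" "n \<notin> arc2"
  shows "stretch n \<in> arc1"
proof (cases "n = 1")
  case True
  then show ?thesis
    by (auto simp: arc1_def intro!: exI[of _ "1::nat"])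
next
  case False
  then obtain k where k: "2 * 4 ^ k \<le> n" "n < 8 * 4 ^ k"
    using assms(1) obtain_block[of n] by (metis One_nat_def Suc_1 Suc_leI le_neq_implies_less)
  have "n < 6 * 4 ^ k"
  proof (rule ccontr)
    assume "\<not> n < 6 * 4 ^ k"
    then have "n \<in> arc2"
      using k unfolding arc2_def by (auto intro!: exI[of _ "Suc k"])
    with assms(2) show False ..
  qed
  then show ?thesis
    using k unfolding arc1_def by (auto simp: stretch_block[OF k] intro!: exI[of _ "k + 2"])
qed

lemma mult_4_mem_arc_iff:
  assumes "0 < n"
  shows "4 * n \<in> arc1 \<longleftrightarrow> n \<in> arc1" and "4 * n \<in> arc2 \<longleftrightarrow> n \<in> arc2"
proof -
  \<comment> \<open>For positive \<open>n\<close>, exponent 0 never witnesses membership of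
    \<open>4 * n\<close>.\<close>
  have shift: "(\<exists>k. P k) \<longleftrightarrow> (\<exists>k. P (Suc k))" if "\<not> P 0" for P :: "nat \<Rightarrow> bool"
    using that by (metis not0_implies_Suc)
  have "(\<exists>k. 4 ^ k \<le> 4 * n \<and> 2 * (4 * n) < 3 * 4 ^ k) \<longleftrightarrow> (\<exists>k. 4 ^ k \<le> n \<and> 2 * n < 3 * 4 ^ k)"
    using assms by (subst shift) auto
  then show "4 * n \<in> arc1 \<longleftrightarrow> n \<in> arc1"
    by (simp add: arc1_def)
  have "(\<exists>k. 3 * 4 ^ k \<le> 2 * (4 * n) \<and> 4 * n < 2 * 4 ^ k) \<longleftrightarrow> (\<exists>k. 3 * 4 ^ k \<le> 2 * n \<and> n < 2 * 4 ^ k)"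
    using assms by (subst shift) auto
  then show "4 * n \<in> arc2 \<longleftrightarrow> n \<in> arc2"
    by (simp add: arc2_def)
qed

subsection \<open>An equivariant map from sequences to the circle\<close>

definition tail_eq :: "(nat \<Rightarrow> 'a) \<Rightarrow> (nat \<Rightarrow> 'a) \<Rightarrow> bool" where
  "tail_eq u v \<longleftrightarrow> (\<exists>i j. \<forall>k. u (k + i) = v (k + j))"

lemma tail_eq_refl: "tail_eq u u"
  and tail_eq_sym: "tail_eq u v \<Longrightarrow> tail_eq v u"
  unfolding tail_eq_def by metis+

lemma tail_eq_trans:
  assumes "tail_eq u v" "tail_eq v w"
  shows "tail_eq u w"
proof -
  obtain i j i' j' where *: "\<And>k. u (k + i) = v (k + j)" "\<And>k. v (k + i') = w (k + j')"
    using assms unfolding tail_eq_def by metis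
  have "u (k + (i + i')) = w (k + (j + j'))" for k
    using *(1)[of "k + i'"] *(2)[of "k + j"] by (simp add: ac_simps)
  then show ?thesis
    unfolding tail_eq_def by blast
qed

text \<open>Replacing \<open>n\<close> by \<open>4 * n\<close> shifts the ray by one, so up to
  \<open>tail_eq\<close> it depends only on the point of the circle.\<close>

definition ray :: "(nat \<Rightarrow> 'a) \<Rightarrow> nat \<Rightarrow> nat \<Rightarrow> 'a" where
  "ray x n k = x (4 ^ k * n)"

definition germs :: "(nat \<Rightarrow> 'a) \<Rightarrow> (nat \<Rightarrow> 'a) set" where
  "germs x = {u. \<exists>n>0. tail_eq u (ray x n)}"

text \<open>
  A choice of germ that depends only on \<open>germs x\<close> makes the point of the circle at which \<open>x\<close>
  has the chosen germ equivariant in \<open>x\<close>.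
\<close>

definition circle_point :: "(nat \<Rightarrow> 'a) \<Rightarrow> nat" where
  "circle_point x = (SOME n. 0 < n \<and> tail_eq (SOME u. u \<in> germs x) (ray x n))"

lemma circle_point:
  "0 < circle_point x" "tail_eq (SOME u. u \<in> germs x) (ray x (circle_point x))"
proof -
  have "ray x 1 \<in> germs x"
    unfolding germs_def using tail_eq_refl zero_less_one by blast
  then have "(SOME u. u \<in> germs x) \<in> germs x"
    by (rule someI[of "\<lambda>u. u \<in> germs x"])
  then have "\<exists>n. 0 < n \<and> tail_eq (SOME u. u \<in> germs x) (ray x n)"
    by (auto simp: germs_def)
  from someI_ex[OF this]
  show "0 < circle_point x" "tail_eq (SOME u. u \<in> germs x) (ray x (circle_point x))"
    by (simp_all add: circle_point_def)
qed

locale circle_bijection =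
  fixes a :: "nat \<Rightarrow> nat"
  assumes mult_4: "a (4 * n) = 4 * a n" and pos: "0 < n \<Longrightarrow> 0 < a n"
    and surj: "0 < n \<Longrightarrow> \<exists>j. \<exists>m>0. 4 ^ j * n = a m"
begin

lemma mult_power_4: "a (4 ^ k * n) = 4 ^ k * a n"
  by (induction k) (simp_all add: mult_4 mult.assoc)

lemma ray_comp: "ray (x \<circ> a) n = ray x (a n)"
  by (simp add: ray_def fun_eq_iff mult_power_4)

text \<open>The rays of \<open>x \<circ> a\<close> are those of \<open>x\<close> at the points
  \<open>a n\<close>, which exhaust the circle.\<close>

lemma germs_comp: "germs (x \<circ> a) = germs x"
proof -
  have "\<exists>m>0. tail_eq u (ray x (a m))" if "0 < n" "tail_eq u (ray x n)" for u n
  proof -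
    obtain j m where jm: "0 < m" "4 ^ j * n = a m"
      using surj[OF \<open>0 < n\<close>] by blast
    have "ray x n (k + j) = ray x (a m) (k + 0)" for k
      by (simp add: ray_def jm(2)[symmetric] power_add mult.assoc)
    then have "tail_eq (ray x n) (ray x (a m))"
      unfolding tail_eq_def by blast
    then show ?thesis
      using jm(1) that(2) tail_eq_trans by blast
  qed
  then show ?thesis
    unfolding germs_def ray_comp using pos by blast
qed

text \<open>Equal germ sets yield the same chosen germ, so two rays of \<open>x\<close> share a
  value, and injectivity of \<open>x\<close> identifies the indices.\<close>

lemma circle_point_comp:
  assumes "inj x"
  obtains i j where "4 ^ i * a (circle_point (x \<circ> a)) = 4 ^ j * circle_point x"
proof -
  have "tail_eq (ray x (a (circle_point (x \<circ> a)))) (ray x (circle_point x))"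
    using circle_point(2)[of "x \<circ> a"] circle_point(2)[of x] tail_eq_sym tail_eq_trans
    unfolding germs_comp ray_comp by blast
  then obtain i j where "\<And>k. ray x (a (circle_point (x \<circ> a))) (k + i) = ray x (circle_point x) (k + j)"
    unfolding tail_eq_def by blast
  from this[of 0] show thesis
    using that[of i j] injD[OF assms] by (simp add: ray_def)
qed

lemma circle_point_comp_mem_iff:
  assumes "inj x" and D: "\<And>n. 0 < n \<Longrightarrow> 4 * n \<in> D \<longleftrightarrow> n \<in> D"
  shows "a (circle_point (x \<circ> a)) \<in> D \<longleftrightarrow> circle_point x \<in> D"
proof -
  have pow: "4 ^ i * n \<in> D \<longleftrightarrow> n \<in> D" if "0 < n" for i n
    using that by (induction i) (simp_all add: D mult.assoc)
  obtain i j where "4 ^ i * a (circle_point (x \<circ> a)) = 4 ^ j * circle_point x"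
    by (rule circle_point_comp[OF assms(1)])
  then show ?thesis
    using pow pos circle_point(1) by metis
qed

end

section \<open>The ping-pong contradiction for surjections\<close>

lemma circle_bijection_stretch: "circle_bijection stretch"
proof
  show "0 < stretch n" if "0 < n" for n
    using strict_monoD[OF strict_mono_stretch that] by simp
  show "\<exists>j. \<exists>m>0. 4 ^ j * n = stretch m" if "0 < n" for n
    by (rule exI[of _ 3]) (use stretch_surj[OF that] in simp)
qed (rule stretch_mult_4)

lemma circle_bijection_double: "circle_bijection (\<lambda>n. 2 * n)"
proof
  show "\<exists>j. \<exists>m>0. 4 ^ j * n = 2 * m" if "0 < n" for n :: nat
    using that by (intro exI[of _ 1] exI[of _ "2 * n"]) simp
qed simp_all

text \<open>The law of \<open>circle_point (lower_adjoint t)\<close> on the circle is invariant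
  under \<open>stretch\<close> and doubling. By \<open>stretch\<close>, \<open>arc1\<close> weighs
  at least as much as the complement of \<open>arc2\<close>, so both arcs together have measure 1;
  doubling moves them off themselves, allowing at most 1/2.\<close>

lemma not_amenable_Epi_le: "\<not> amenable TYPE(day_space) Epi_le"
proof
  let ?S = "{f :: nat \<Rightarrow> nat. mono f \<and> surj f}"
  assume "amenable TYPE(day_space) Epi_le"
  then obtain \<mu> where "invariant_measure ?S \<mu>"
    using amenable_imp_invariant_measure monoid_Epi_le unfolding Epi_le_def by blast
  then interpret invariant_measure ?S \<mu> .
  define P where "P a D = {t. circle_point (lower_adjoint t \<circ> a) \<in> D}" for a D
  have inv: "\<mu> (P e D) = \<mu> (P id D)" if e: "strict_mono e" "e 0 = 0" for e D
  proof -
    have "upper_adjoint e \<in> ?S"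
      using e by (simp add: mono_upper_adjoint surj_upper_adjoint)
    moreover have "P e D = {t. upper_adjoint e \<circ> t \<in> P id D}"
      by (simp add: P_def lower_adjoint_upper_adjoint_comp[OF e])
    ultimately show ?thesis
      using invariant by simp
  qed
  have inj: "inj (lower_adjoint t)" if "t \<in> ?S" for t
    using strict_mono_lower_adjoint[of t] that by (simp add: strict_mono_imp_inj_on)
  have double: "strict_mono (\<lambda>n :: nat. 2 * n)"
    by (simp add: strict_mono_def)
  have "P stretch (- arc2) \<inter> ?S \<subseteq> P id arc1"
  proof
    fix t
    assume t: "t \<in> P stretch (- arc2) \<inter> ?S"
    then have "stretch (circle_point (lower_adjoint t \<circ> stretch)) \<in> arc1"
      by (intro stretch_in_arc1 circle_point(1)) (simp add: P_def)
    then show "t \<in> P id arc1"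
      using circle_bijection.circle_point_comp_mem_iff[OF circle_bijection_stretch inj mult_4_mem_arc_iff(1)] t
      by (simp add: P_def)
  qed
  then have "\<mu> (P id (- arc2)) \<le> \<mu> (P id arc1)"
    unfolding inv[OF strict_mono_stretch stretch_0, symmetric, of "- arc2"] by (rule measure_mono)
  moreover have "\<mu> (P id arc2) + \<mu> (P id (- arc2)) = 1"
  proof -
    have "P id (- arc2) = - P id arc2"
      by (auto simp: P_def)
    then show ?thesis
      by (simp add: measure_compl)
  qed
  moreover have "\<mu> (P id (arc1 \<union> arc2)) = \<mu> (P id arc1) + \<mu> (P id arc2)"
  proof -
    have "P id (arc1 \<union> arc2) = P id arc1 \<union> P id arc2" "P id arc1 \<inter> P id arc2 = {}"
      using arc1_arc2_disjoint by (auto simp: P_def)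
    then show ?thesis
      using additive by simp
  qed
  ultimately have ge_1: "1 \<le> \<mu> (P id (arc1 \<union> arc2))"
    by linarith
  have "P (\<lambda>n. 2 * n) (arc1 \<union> arc2) \<inter> ?S \<subseteq> - P id (arc1 \<union> arc2)"
  proof
    fix t
    assume t: "t \<in> P (\<lambda>n. 2 * n) (arc1 \<union> arc2) \<inter> ?S"
    then have "2 * circle_point (lower_adjoint t \<circ> (\<lambda>n. 2 * n)) \<notin> arc1 \<union> arc2"
      by (intro double_notin_arcs) (simp add: P_def)
    moreover have "4 * n \<in> arc1 \<union> arc2 \<longleftrightarrow> n \<in> arc1 \<union> arc2" if "0 < n" for n
      using mult_4_mem_arc_iff[OF that] by simp
    ultimately show "t \<in> - P id (arc1 \<union> arc2)"
      using circle_bijection.circle_point_comp_mem_iff[OF circle_bijection_double inj, of t "arc1 \<union> arc2"] t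
      by (simp add: P_def)
  qed
  then have "\<mu> (P id (arc1 \<union> arc2)) \<le> \<mu> (- P id (arc1 \<union> arc2))"
    unfolding inv[OF double mult_0_right, symmetric, of "arc1 \<union> arc2"] by (rule measure_mono)
  moreover have "\<mu> (P id (arc1 \<union> arc2)) + \<mu> (- P id (arc1 \<union> arc2)) = 1"
    by (simp add: measure_compl)
  ultimately show False
    using ge_1 by linarith
qed

theorem theoremB1:
  shows "(\<forall>M \<in> {End_le, Emb_le, Epi_le, End_le_unbounded}.
            topologically_amenable TYPE('v::real_vector) M (pointwise_topology M)) \<and>
         (\<forall>M \<in> {End_le, Emb_le, Epi_le, End_le_unbounded}.
            \<not> amenable TYPE(day_space) M)"
proof -
  have "\<not> amenable TYPE(day_space) End_le"
    unfolding End_le_def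
    by (rule not_amenable_with_embeddings[OF monoid_End_le[unfolded End_le_def]]) auto
  moreover have "\<not> amenable TYPE(day_space) Emb_le"
    unfolding Emb_le_def
    by (rule not_amenable_with_embeddings[OF monoid_Emb_le[unfolded Emb_le_def]]) auto
  moreover have "\<not> amenable TYPE(day_space) End_le_unbounded"
    unfolding End_le_unbounded_def
    by (rule not_amenable_with_embeddings[OF monoid_End_le_unbounded[unfolded End_le_unbounded_def]])
      (auto simp: inj_not_bdd_above)
  ultimately show ?thesis
    using not_amenable_Epi_le topologically_amenable_End_le topologically_amenable_Emb_le
      topologically_amenable_Epi_le topologically_amenable_End_le_unbounded
    by blast
qed

end
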